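(* Let $A=(a_{ij})\in\mathbb{R}^{m\times n}$ be an arbitrary nonzero matrix and $b\in\mathbb{R}^m$ such that the system of linear inequalities $Ax\le b$ is feasible, and let $S=\{x\in\mathbb{R}^n: Ax\le b\}$ be its solution set. Let $\tau>0$ be a Hoffman constant for $A$ (as defined in the context). Let $x^{+}$ be the (random) point obtained from $x\in\mathbb{R}^n$ by one iteration of the doubly stochastic alternating projection algorithm (described in the context) with stepsize $\alpha=\frac1n$. Then $$\mathbb{E}\left[\mathrm{dist}^2(x^{+},S)\mid x\right]\le\left(1-\frac{1}{n\,\tau^2\sum_{i,j}a_{ij}^2}\right)\mathrm{dist}^2(x,S).$$
   Context: Doubly stochastic alternating projection algorithm for finding $x$ with $A_{i:}x\le b_i$, $i=1,\dots,m$ (where $A_{i:}$ is the $i$-th row of $A$), with stepsize $\alpha>0$: given the current iterate $x\in\mathbb{R}^n$, select one index pair $(i,j)\in\{1,\dots,m\}\times\{1,\dots,n\}$ with probability $p_{ij}=a_{ij}^2/\sum_{i',j'}a_{i'j'}^2$ (so pairs with $a_{ij}=0$ are never selected). If $A_{i:}x\le b_i$, set $x^{+}=x$. Otherwise set $$x_j^{+}=x_j+\alpha\,\frac{b_i-\sum_{k=1}^n a_{ik}x_k}{a_{ij}},\qquad x_k^{+}=x_k\ \text{ for all } k\ne j .$$ Distance: $\mathrm{dist}(x,S)=\inf_{y\in S}\|x-y\|$ with the Euclidean norm. Hoffman constant: $\tau>0$ is a constant, independent of $b$, such that whenever the solution set $S$ of $Ax\le b$ is nonempty, $\mathrm{dist}(x,S)\le\tau\,\|(Ax-b)^{+}\|$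 for all $x\in\mathbb{R}^n$, where $(Ax-b)^{+}$ has components $(Ax-b)^{+}_i=\max\{0,A_{i:}x-b_i\}$. (Such a constant exists by Hoffman's error bound.) *)

theory Defs
  imports "HOL-Probability.Probability"
begin

definition solution_set :: "real ^ 'n ^ 'm \<Rightarrow> real ^ 'm \<Rightarrow> (real ^ 'n) set" where
  "solution_set A b = {x. \<forall>i. (A *v x) $ i \<le> b $ i}"

definition positive_part :: "real ^ 'm \<Rightarrow> real ^ 'm" where
  "positive_part v = (\<chi> i. max 0 (v $ i))"

text \<open>The constant must work for all feasible right-hand sides \<open>b\<close> simultaneously.\<close>

definition hoffman_constant :: "real ^ 'n ^ 'm \<Rightarrow> real \<Rightarrow> bool" where
  "hoffman_constant A \<tau> \<longleftrightarrow> \<tau> > 0 \<and>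
     (\<forall>b. solution_set A b \<noteq> {} \<longrightarrow>
        (\<forall>x. infdist x (solution_set A b) \<le> \<tau> * norm (positive_part (A *v x - b))))"

text \<open>For \<open>A \<noteq> 0\<close> the weights below sum to one (lemma \<open>pmf_index_pair_pmf\<close>);
  for \<open>A = 0\<close> this is an unspecified distribution.\<close>

definition index_pair_pmf :: "real ^ 'n ^ 'm \<Rightarrow> ('m \<times> 'n) pmf" where
  "index_pair_pmf A =
     embed_pmf (\<lambda>(i, j). (A $ i $ j)\<^sup>2 / (\<Sum>i'\<in>UNIV. \<Sum>j'\<in>UNIV. (A $ i' $ j')\<^sup>2))"

text \<open>When \<open>A $ i $ j = 0\<close> the quotient takes the value \<open>0\<close> by convention, but such
  pairs are selected with probability zero.\<close>

definition ds_update ::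
    "real ^ 'n ^ 'm \<Rightarrow> real ^ 'm \<Rightarrow> real \<Rightarrow> real ^ 'n \<Rightarrow> 'm \<times> 'n \<Rightarrow> real ^ 'n" where
  "ds_update A b \<alpha> x = (\<lambda>(i, j).
     if (A *v x) $ i \<le> b $ i then x
     else (\<chi> k. if k = j
                then x $ j + \<alpha> * ((b $ i - (\<Sum>l\<in>UNIV. A $ i $ l * x $ l)) / A $ i $ j)
                else x $ k))"

text \<open>The distribution of the next iterate, given the current iterate \<open>x\<close>.\<close>

definition ds_iteration ::
    "real ^ 'n ^ 'm \<Rightarrow> real ^ 'm \<Rightarrow> real \<Rightarrow> real ^ 'n \<Rightarrow> (real ^ 'n) pmf" where
  "ds_iteration A b \<alpha> x = map_pmf (ds_update A b \<alpha> x) (index_pair_pmf A)"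

lemma sum_squares_entries_pos:
  fixes A :: "real ^ 'n ^ 'm"
  assumes "A \<noteq> 0"
  shows "(\<Sum>i\<in>UNIV. \<Sum>j\<in>UNIV. (A $ i $ j)\<^sup>2) > 0"
proof -
  obtain i j where ij: "A $ i $ j \<noteq> 0"
    using assms by (auto simp: vec_eq_iff)
  have "0 < (\<Sum>j\<in>UNIV. (A $ i $ j)\<^sup>2)"
    using ij by (intro sum_pos2[of _ j]) auto
  then show ?thesis
    by (intro sum_pos2[of _ i]) (auto intro: sum_nonneg)
qed

lemma pmf_index_pair_pmf:
  fixes A :: "real ^ 'n ^ 'm"
  assumes "A \<noteq> 0"
  shows "pmf (index_pair_pmf A) (i, j) =
    (A $ i $ j)\<^sup>2 / (\<Sum>i'\<in>UNIV. \<Sum>j'\<in>UNIV. (A $ i' $ j')\<^sup>2)"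
proof -
  define F where "F = (\<Sum>i\<in>UNIV. \<Sum>j\<in>UNIV. (A $ i $ j)\<^sup>2)"
  define p where "p = (\<lambda>(i, j). (A $ i $ j)\<^sup>2 / F)"
  have F: "F > 0"
    unfolding F_def by (rule sum_squares_entries_pos[OF assms])
  then have nn: "p z \<ge> 0" for z
    by (cases z) (simp add: p_def)
  have "(\<Sum>z\<in>UNIV. p z) = (\<Sum>i\<in>UNIV. \<Sum>j\<in>UNIV. (A $ i $ j)\<^sup>2 / F)"
    by (simp add: p_def sum.cartesian_product flip: UNIV_Times_UNIV)
  also have "\<dots> = F / F"
    by (simp only: F_def flip: sum_divide_distrib)
  finally have "(\<Sum>z\<in>UNIV. p z) = 1"
    using F by simp
  then have "(\<integral>\<^sup>+ z. ennreal (p z) \<partial>count_space UNIV) = 1"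
    using nn by (simp add: nn_integral_count_space_finite sum_ennreal)
  then have "pmf (embed_pmf p) (i, j) = p (i, j)"
    using nn by (intro pmf_embed_pmf) auto
  then show ?thesis
    by (simp add: index_pair_pmf_def p_def F_def)
qed

end

theory Submission
  imports Defs
begin

text \<open>
  Write \<open>r\<close> for the positive part of \<open>A x - b\<close>, \<open>F\<close> for the sum of the squared entries of \<open>A\<close>,
  let \<open>\<alpha> \<ge> 0\<close>, and fix a feasible point \<open>y\<close>. Selecting \<open>(i, j)\<close> subtracts \<open>\<alpha> r\<^sub>i / a\<^sub>i\<^sub>j\<close> from the \<open>j\<close>-th coordinate,
  and this also covers the case of a satisfied constraint, where \<open>r\<^sub>i = 0\<close>. Expanding the square,
  the selection weight \<open>a\<^sub>i\<^sub>j\<^sup>2 / F\<close> cancels the denominators: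
  the squared distance to \<open>y\<close> changes, after weighting, by at most
  \<open>(- 2 \<alpha> r\<^sub>i a\<^sub>i\<^sub>j (x - y)\<^sub>j + \<alpha>\<^sup>2 r\<^sub>i\<^sup>2) / F\<close>.
  Summing over \<open>j\<close> reassembles the full row in the linear term, so although only one coordinate
  moves, the average behaves like a step along the row; feasibility of \<open>y\<close> then gives
  \<open>r\<^sub>i (A (x - y))\<^sub>i \<ge> r\<^sub>i\<^sup>2\<close>. The quadratic term is counted once for each of the \<open>n\<close> columns.
  Hence the expected squared distance to \<open>y\<close> drops by at least
  \<open>(2 \<alpha> - n \<alpha>\<^sup>2) \<parallel>r\<parallel>\<^sup>2 / F\<close> (lemma \<open>expected_sq_dist_to_feasible_point\<close>), and
  \<open>\<alpha> = 1 / n\<close> maximises the coefficient, giving \<open>1 / n\<close>.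

  Taking for \<open>y\<close> the point of the solution set nearest to \<open>x\<close> turns this into a bound on the
  distance to the solution set, since \<open>y\<close> remains a competitor for the new iterate. The Hoffman bound
  \<open>\<parallel>r\<parallel>\<^sup>2 \<ge> dist\<^sup>2 / \<tau>\<^sup>2\<close> makes the decrease proportional to the squared distance itself.
\<close>

lemma closed_solution_set: "closed (solution_set A b)"
proof -
  have "solution_set A b = (\<Inter>i. {x. (A *v x) $ i \<le> b $ i})"
    by (auto simp: solution_set_def)
  moreover have "closed {x. (A *v x) $ i \<le> b $ i}" for i
    by (intro closed_Collect_le continuous_intros matrix_vector_mult_linear_continuous_on)
  ultimately show ?thesis
    by auto
qed

lemma ds_update_eq_coordinate_step:
  "ds_update A b \<alpha> x (i, j) =
     x - axis j (\<alpha> * positive_part (A *v x - b) $ i / A $ i $ j)"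
  by (auto simp: ds_update_def positive_part_def vec_eq_iff axis_def
      matrix_vector_mult_def max_def field_simps diff_divide_distrib)

lemma norm_diff_axis_sq:
  fixes v :: "real ^ 'n"
  shows "(norm (v - axis j c))\<^sup>2 = (norm v)\<^sup>2 - 2 * c * v $ j + c\<^sup>2"
  unfolding power2_norm_eq_inner inner_diff_left inner_diff_right
  by (simp add: inner_axis inner_axis' power2_eq_square algebra_simps)

text \<open>
  The inequality is strict only for \<open>a\<^sub>i\<^sub>j = 0\<close>: such pairs have weight zero but are still charged the
  term \<open>(\<alpha> r\<^sub>i)\<^sup>2\<close>, which is what makes the stepsize depend on the number of columns rather than on
  the number of nonzero entries of a row.
\<close>

lemma weighted_sq_dist_update_le:
  fixes A :: "real ^ 'n ^ 'm"
  defines "r \<equiv> \<lambda>x b. positive_part (A *v x - b)"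
  shows "(A $ i $ j)\<^sup>2 * (norm (ds_update A b \<alpha> x (i, j) - y))\<^sup>2
    \<le> (A $ i $ j)\<^sup>2 * (norm (x - y))\<^sup>2
       - 2 * \<alpha> * r x b $ i * (A $ i $ j * (x - y) $ j) + \<alpha>\<^sup>2 * (r x b $ i)\<^sup>2"
proof (cases "A $ i $ j = 0")
  case False
  have "ds_update A b \<alpha> x (i, j) - y = (x - y) - axis j (\<alpha> * r x b $ i / A $ i $ j)"
    by (simp add: ds_update_eq_coordinate_step r_def)
  then have "(A $ i $ j)\<^sup>2 * (norm (ds_update A b \<alpha> x (i, j) - y))\<^sup>2
    = (A $ i $ j)\<^sup>2 * ((norm (x - y))\<^sup>2 - 2 * (\<alpha> * r x b $ i / A $ i $ j) * (x - y) $ j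
        + (\<alpha> * r x b $ i / A $ i $ j)\<^sup>2)"
    by (simp only: norm_diff_axis_sq)
  also have "\<dots> = (A $ i $ j)\<^sup>2 * (norm (x - y))\<^sup>2
      - 2 * \<alpha> * r x b $ i * (A $ i $ j * (x - y) $ j) + \<alpha>\<^sup>2 * (r x b $ i)\<^sup>2"
    using False by (simp add: power2_eq_square field_simps)
  finally show ?thesis
    by simp
qed simp

text \<open>
  For satisfied constraints both sides vanish; for violated ones
  \<open>r\<^sub>i = (A x)\<^sub>i - b\<^sub>i \<le> (A x)\<^sub>i - (A y)\<^sub>i\<close>.
\<close>

lemma residual_sq_le_residual_times_row:
  assumes "y \<in> solution_set A b"
  shows "(positive_part (A *v x - b) $ i)\<^sup>2
    \<le> positive_part (A *v x - b) $ i * (A *v (x - y)) $ i"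
proof -
  have "(A *v y) $ i \<le> b $ i"
    using assms by (simp add: solution_set_def)
  then show ?thesis
    by (auto simp: positive_part_def max_def power2_eq_square matrix_vector_mult_diff_distrib
        intro: mult_left_mono)
qed

lemma expectation_ds_iteration:
  fixes A :: "real ^ 'n ^ 'm"
  assumes "A \<noteq> 0"
  shows "measure_pmf.expectation (ds_iteration A b \<alpha> x) f =
    (\<Sum>i\<in>UNIV. \<Sum>j\<in>UNIV. (A $ i $ j)\<^sup>2 * f (ds_update A b \<alpha> x (i, j)))
      / (\<Sum>i\<in>UNIV. \<Sum>j\<in>UNIV. (A $ i $ j)\<^sup>2)"
proof -
  define F where "F = (\<Sum>i\<in>UNIV. \<Sum>j\<in>UNIV. (A $ i $ j)\<^sup>2)"
  have "measure_pmf.expectation (ds_iteration A b \<alpha> x) f =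
      (\<Sum>z\<in>UNIV. f (ds_update A b \<alpha> x z) * pmf (index_pair_pmf A) z)"
    unfolding ds_iteration_def integral_map_pmf
    by (rule integral_measure_pmf_real) auto
  also have "\<dots> = (\<Sum>i\<in>UNIV. \<Sum>j\<in>UNIV.
      f (ds_update A b \<alpha> x (i, j)) * pmf (index_pair_pmf A) (i, j))"
    by (simp add: sum.cartesian_product flip: UNIV_Times_UNIV)
  also have "\<dots> = (\<Sum>i\<in>UNIV. \<Sum>j\<in>UNIV. (A $ i $ j)\<^sup>2 * f (ds_update A b \<alpha> x (i, j))) / F"
    by (simp add: pmf_index_pair_pmf[OF assms] F_def sum_divide_distrib mult.commute)
  finally show ?thesis
    by (simp add: F_def)
qed

lemma expected_sq_dist_to_feasible_point:
  fixes A :: "real ^ 'n ^ 'm"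
  assumes A: "A \<noteq> 0" and y: "y \<in> solution_set A b" and \<alpha>: "\<alpha> \<ge> 0"
  shows "measure_pmf.expectation (ds_iteration A b \<alpha> x) (\<lambda>z. (norm (z - y))\<^sup>2)
    \<le> (norm (x - y))\<^sup>2 - (2 * \<alpha> - real CARD('n) * \<alpha>\<^sup>2)
         * (norm (positive_part (A *v x - b)))\<^sup>2 / (\<Sum>i\<in>UNIV. \<Sum>j\<in>UNIV. (A $ i $ j)\<^sup>2)"
proof -
  define r where "r = positive_part (A *v x - b)"
  define F where "F = (\<Sum>i\<in>UNIV. \<Sum>j\<in>UNIV. (A $ i $ j)\<^sup>2)"
  have F: "F > 0"
    unfolding F_def by (rule sum_squares_entries_pos[OF A])
  have row: "(\<Sum>j\<in>UNIV. (A $ i $ j)\<^sup>2 * (norm (ds_update A b \<alpha> x (i, j) - y))\<^sup>2)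
      \<le> (\<Sum>j\<in>UNIV. (A $ i $ j)\<^sup>2) * (norm (x - y))\<^sup>2
         - (2 * \<alpha> - real CARD('n) * \<alpha>\<^sup>2) * (r $ i)\<^sup>2" for i
  proof -
    have "(\<Sum>j\<in>UNIV. (A $ i $ j)\<^sup>2 * (norm (ds_update A b \<alpha> x (i, j) - y))\<^sup>2)
        \<le> (\<Sum>j\<in>UNIV. (A $ i $ j)\<^sup>2 * (norm (x - y))\<^sup>2
             - 2 * \<alpha> * r $ i * (A $ i $ j * (x - y) $ j) + \<alpha>\<^sup>2 * (r $ i)\<^sup>2)"
      unfolding r_def by (intro sum_mono weighted_sq_dist_update_le)
    also have "\<dots> = (\<Sum>j\<in>UNIV. (A $ i $ j)\<^sup>2) * (norm (x - y))\<^sup>2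
        - 2 * \<alpha> * (r $ i * (A *v (x - y)) $ i) + real CARD('n) * \<alpha>\<^sup>2 * (r $ i)\<^sup>2"
      by (simp only: sum.distrib sum_subtractf sum_distrib_left[symmetric]
          sum_distrib_right[symmetric] matrix_vector_mult_def vec_lambda_beta sum_constant mult.assoc
          mult.left_commute[of "\<alpha>\<^sup>2"])
    also have "\<dots> \<le> (\<Sum>j\<in>UNIV. (A $ i $ j)\<^sup>2) * (norm (x - y))\<^sup>2
        - 2 * \<alpha> * (r $ i)\<^sup>2 + real CARD('n) * \<alpha>\<^sup>2 * (r $ i)\<^sup>2"
      using residual_sq_le_residual_times_row[OF y] \<alpha>
      by (simp add: r_def mult_left_mono)
    finally show ?thesis
      by (simp add: algebra_simps)
  qed
  have norm_r: "(norm r)\<^sup>2 = (\<Sum>i\<in>UNIV. (r $ i)\<^sup>2)"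
    by (simp add: norm_vec_def L2_set_def sum_nonneg)
  have "(\<Sum>i\<in>UNIV. \<Sum>j\<in>UNIV. (A $ i $ j)\<^sup>2 * (norm (ds_update A b \<alpha> x (i, j) - y))\<^sup>2)
      \<le> (\<Sum>i\<in>UNIV. (\<Sum>j\<in>UNIV. (A $ i $ j)\<^sup>2) * (norm (x - y))\<^sup>2
           - (2 * \<alpha> - real CARD('n) * \<alpha>\<^sup>2) * (r $ i)\<^sup>2)"
    by (intro sum_mono row)
  also have "\<dots> = F * (norm (x - y))\<^sup>2 - (2 * \<alpha> - real CARD('n) * \<alpha>\<^sup>2) * (norm r)\<^sup>2"
    by (simp only: sum_subtractf sum_distrib_left[symmetric] sum_distrib_right[symmetric]
        F_def norm_r)
  finally show ?thesis
    using F unfolding expectation_ds_iteration[OF A] F_def[symmetric] r_def[symmetric]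
    by (simp add: field_simps)
qed

theorem theorem4:
  fixes A :: "real ^ 'n ^ 'm" and b :: "real ^ 'm" and x :: "real ^ 'n" and \<tau> :: real
  assumes "A \<noteq> 0"
    and "solution_set A b \<noteq> {}"
    and "hoffman_constant A \<tau>"
  shows "measure_pmf.expectation (ds_iteration A b (1 / real CARD('n)) x)
           (\<lambda>y. (infdist y (solution_set A b))\<^sup>2)
         \<le> (1 - 1 / (real CARD('n) * \<tau>\<^sup>2 * (\<Sum>i\<in>UNIV. \<Sum>j\<in>UNIV. (A $ i $ j)\<^sup>2)))
            * (infdist x (solution_set A b))\<^sup>2"
proof -
  define S where "S = solution_set A b"
  define n where "n = real CARD('n)"
  define F where "F = (\<Sum>i\<in>UNIV. \<Sum>j\<in>UNIV. (A $ i $ j)\<^sup>2)"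
  define r where "r = positive_part (A *v x - b)"
  have F: "F > 0"
    unfolding F_def by (rule sum_squares_entries_pos[OF assms(1)])
  have n: "n > 0"
    by (simp add: n_def)
  have \<tau>: "\<tau> > 0" and hoffman: "infdist x S \<le> \<tau> * norm r"
    using assms(2,3) by (auto simp: hoffman_constant_def S_def r_def)
  obtain y where y: "y \<in> S" and dist_y: "infdist x S = dist x y"
    using infdist_attains_inf[of S x] assms(2) closed_solution_set by (auto simp: S_def)
  have "(infdist x S)\<^sup>2 \<le> \<tau>\<^sup>2 * (norm r)\<^sup>2"
    using power_mono[OF hoffman infdist_nonneg, of 2] by (simp add: power_mult_distrib)
  then have decrease: "(infdist x S)\<^sup>2 / (n * \<tau>\<^sup>2 * F) \<le> (norm r)\<^sup>2 / (n * F)"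
    using \<tau> F n by (simp add: field_simps)
  have "measure_pmf.expectation (ds_iteration A b (1 / n) x) (\<lambda>z. (infdist z S)\<^sup>2)
      \<le> measure_pmf.expectation (ds_iteration A b (1 / n) x) (\<lambda>z. (norm (z - y))\<^sup>2)"
    unfolding expectation_ds_iteration[OF assms(1)] F_def[symmetric]
    using F y infdist_le[of y S]
    by (intro divide_right_mono sum_mono mult_left_mono power_mono)
      (auto simp: infdist_nonneg simp flip: dist_norm)
  also have "\<dots> \<le> (norm (x - y))\<^sup>2 - (2 * (1 / n) - n * (1 / n)\<^sup>2) * (norm r)\<^sup>2 / F"
    unfolding n_def r_def F_def using y
    by (intro expected_sq_dist_to_feasible_point assms) (auto simp: S_def)
  also have "\<dots> = (infdist x S)\<^sup>2 - (norm r)\<^sup>2 / (n * F)"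
    using n by (simp add: dist_y dist_norm power2_eq_square)
  also have "\<dots> \<le> (1 - 1 / (n * \<tau>\<^sup>2 * F)) * (infdist x S)\<^sup>2"
    using decrease by (simp add: algebra_simps)
  finally show ?thesis
    by (simp add: S_def n_def F_def)
qed

end
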